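(* Let $\mathbb{k}$ be an algebraically closed field, $n\ge2$, and $V=\mathbb{k}p_n$ the $1$-dimensional homogeneous vector space of degree $n$. For any $C\in\mathcal M_{n-1}$, all nontrivial central extensions of $\mathfrak p(C)$ (by $V$) form exactly one isomorphism class of diagonally graded commutative algebras if and only if the graph $\mathrm{Gr}(C)$ has exactly one nonvanishing connected component.
   Context: $[m]=\{1,\dots,m\}$. $\mathcal M_m$ is the set of $m\times m$ symmetric matrices $C=(c_{ij})_{i,j\in[m]}$ over $\mathbb{k}$ with $c_{ij}=0$ if $i+j>m$ and $c_{jk}c_{i,j+k}=c_{ij}c_{i+j,k}$ for all $i,j,k\ge 1$ (where $c_{ij}$ is read as $0$ whenever $i+j>m$). For $C\in\mathcal M_m$, the $m$-dimensional diagonally graded commutative algebra (DGCA) $\mathfrak p(C)$ is the $\mathbb N^+$-graded vector space with fixed basis $p_1,\dots,p_m$, $\deg p_i=i$, and multiplication $p_ip_j=c_{ij}p_{i+j}$ (where $p_l=0$ for $l>m$). Isomorphisms are degree-preserving multiplicative linear bijections. For $C\in\mathcal M_{n-1}$, $Z_g^2(\mathfrak p(C),V)$ is the space of graded $2$-cocycles: degree-preserving symmetric bilinear maps $\theta:\mathfrak p(C)\times\mathfrak p(C)\to V$ with $\theta(ab,c)=\theta(a,bc)$. Such $\theta$ satisfies $\theta(p_i,p_j)=\delta_{i+j,n}\theta_ip_n$ and is identified with the tuple $(\theta_i)_{i\in[n-1]}\in\mathbb{k}^{n-1}$; the cocycle conditions are $\theta_i=\theta_{n-i}$ and $\theta_{i+j}c_{ij}=\theta_{j+k}c_{jk}$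 for all $i,j,k\ge1$ with $i+j+k=n$. The central extension $\mathfrak p(C)_\theta$ is $\mathfrak p(C)\oplus V$ with multiplication $(a+v)\cdot_\theta(b+w)=ab+\theta(a,b)$, an $n$-dimensional DGCA. It is nontrivial iff $\theta\ne0$ (there are no nonzero graded coboundaries here). Graph $\mathrm{Gr}(C)$: the undirected simple graph with vertex set $[n-1]$ in which two distinct vertices $p,q$ are adjacent iff $p+q=n$ or there exist $i,j,k\ge1$ with $i+j+k=n$, $p=i+j$, $q=j+k$, $c_{ij}c_{jk}\ne0$. A connected component is contractible if there exist $i,j\ge1$ such that it contains the vertex $i+j$, and $c_{ij}\ne0$ but $c_{j,n-i-j}=0$; otherwise it is generic. A generic connected component is called nonvanishing if some $2$-cocycle $\theta\in Z_g^2(\mathfrak p(C),V)$ takes a nonzero value on it (i.e. $\theta_p\neq0$ for some vertex $p$ of it). *)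

theory Defs
  imports
    "HOL-Computational_Algebra.Polynomial"
    "HOL-Library.Function_Algebras"
    "HOL-Library.Product_Plus"
begin

section \<open>Graded vector spaces and graded algebras\<close>

text \<open>
  A graded vector space is given by its carrier inside an ambient additive group, the scalar
  multiplication, and its homogeneous components; addition is that of the ambient group.
  The records carry data only. Nothing is assumed about operations outside the carrier.
\<close>

record ('a, 'v) graded_space =
  gcarrier :: "'v set"
  gscale :: "'a \<Rightarrow> 'v \<Rightarrow> 'v"
  gcomp :: "nat \<Rightarrow> 'v set"

record ('a, 'v) graded_algebra = "('a, 'v) graded_space" +
  gmult :: "'v \<Rightarrow> 'v \<Rightarrow> 'v"

definition graded_linear_maps ::
  "('a, 'v::ab_group_add, 'y) graded_space_scheme \<Rightarrow> ('a, 'w::ab_group_add, 'z) graded_space_scheme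
    \<Rightarrow> ('v \<Rightarrow> 'w) set"
where
  "graded_linear_maps A B = {f.
     (\<forall>x\<in>gcarrier A. f x \<in> gcarrier B) \<and>
     (\<forall>x\<in>gcarrier A. \<forall>y\<in>gcarrier A. f (x + y) = f x + f y) \<and>
     (\<forall>c. \<forall>x\<in>gcarrier A. f (gscale A c x) = gscale B c (f x)) \<and>
     (\<forall>d. \<forall>x\<in>gcomp A d. f x \<in> gcomp B d)}"

definition isomorphic_graded_algebras ::
  "('a, 'v::ab_group_add) graded_algebra \<Rightarrow> ('a, 'w::ab_group_add) graded_algebra \<Rightarrow> bool"
where
  "isomorphic_graded_algebras A B \<longleftrightarrow>
     (\<exists>f \<in> graded_linear_maps A B. bij_betw f (gcarrier A) (gcarrier B) \<and>
        (\<forall>x\<in>gcarrier A. \<forall>y\<in>gcarrier A. f (gmult A x y) = gmult B (f x) (f y)))"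

definition isomorphism_classes :: "('a, 'v::ab_group_add) graded_algebra set \<Rightarrow>
    ('a, 'v) graded_algebra set set"
where
  "isomorphism_classes X =
     X // {(A, B). A \<in> X \<and> B \<in> X \<and> isomorphic_graded_algebras A B}"


section \<open>Graded cocycles and central extensions\<close>

definition graded_cocycles ::
  "('a, 'v::ab_group_add) graded_algebra \<Rightarrow> ('a, 'w::ab_group_add) graded_space
    \<Rightarrow> ('v \<Rightarrow> 'v \<Rightarrow> 'w) set"
where
  "graded_cocycles A V = {\<theta>.
     (\<forall>a\<in>gcarrier A. \<forall>b\<in>gcarrier A. \<theta> a b \<in> gcarrier V) \<and>
     (\<forall>a\<in>gcarrier A. \<forall>b\<in>gcarrier A. \<theta> a b = \<theta> b a) \<and>
     (\<forall>a\<in>gcarrier A. \<forall>a'\<in>gcarrier A. \<forall>b\<in>gcarrier A. \<theta> (a + a') b = \<theta> a b + \<theta> a' b) \<and>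
     (\<forall>a\<in>gcarrier A. \<forall>b\<in>gcarrier A. \<forall>b'\<in>gcarrier A. \<theta> a (b + b') = \<theta> a b + \<theta> a b') \<and>
     (\<forall>c. \<forall>a\<in>gcarrier A. \<forall>b\<in>gcarrier A. \<theta> (gscale A c a) b = gscale V c (\<theta> a b)) \<and>
     (\<forall>c. \<forall>a\<in>gcarrier A. \<forall>b\<in>gcarrier A. \<theta> a (gscale A c b) = gscale V c (\<theta> a b)) \<and>
     (\<forall>d e. \<forall>a\<in>gcomp A d. \<forall>b\<in>gcomp A e. \<theta> a b \<in> gcomp V (d + e)) \<and>
     (\<forall>a\<in>gcarrier A. \<forall>b\<in>gcarrier A. \<forall>c\<in>gcarrier A.
        \<theta> (gmult A a b) c = \<theta> a (gmult A b c))}"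

definition graded_coboundaries ::
  "('a, 'v::ab_group_add) graded_algebra \<Rightarrow> ('a, 'w::ab_group_add) graded_space
    \<Rightarrow> ('v \<Rightarrow> 'v \<Rightarrow> 'w) set"
where
  "graded_coboundaries A V = {\<theta>.
     \<exists>f \<in> graded_linear_maps A V. \<forall>a\<in>gcarrier A. \<forall>b\<in>gcarrier A. \<theta> a b = f (gmult A a b)}"

text \<open>The pair \<open>(a, v)\<close> stands for \<open>a + v\<close> in the direct sum of \<open>A\<close> and \<open>V\<close>.\<close>

definition central_extension ::
  "('a, 'v::ab_group_add) graded_algebra \<Rightarrow> ('a, 'w::ab_group_add) graded_space
    \<Rightarrow> ('v \<Rightarrow> 'v \<Rightarrow> 'w) \<Rightarrow> ('a, 'v \<times> 'w) graded_algebra"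
where
  "central_extension A V \<theta> =
     \<lparr> gcarrier = gcarrier A \<times> gcarrier V,
       gscale = (\<lambda>c (a, v). (gscale A c a, gscale V c v)),
       gcomp = (\<lambda>d. gcomp A d \<times> gcomp V d),
       gmult = (\<lambda>(a, v) (b, w). (gmult A a b, \<theta> a b)) \<rparr>"

definition nontrivial_central_extensions ::
  "('a, 'v::ab_group_add) graded_algebra \<Rightarrow> ('a, 'w::ab_group_add) graded_space
    \<Rightarrow> ('a, 'v \<times> 'w) graded_algebra set"
where
  "nontrivial_central_extensions A V =
     central_extension A V ` (graded_cocycles A V - graded_coboundaries A V)"


section \<open>The diagonally graded commutative algebras\<close>

text \<open>
  The \<open>m \<times> m\<close> matrices are functions on \<open>{1..m} \<times> {1..m}\<close> extended by zero. This makes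
  the convention that \<open>C i j\<close> is read as \<open>0\<close> whenever \<open>i + j > m\<close> hold for
  indices beyond \<open>m\<close> as well.
\<close>

definition structure_matrices :: "nat \<Rightarrow> (nat \<Rightarrow> nat \<Rightarrow> 'a::field) set" where
  "structure_matrices m = {C.
     (\<forall>i j. i \<notin> {1..m} \<or> j \<notin> {1..m} \<longrightarrow> C i j = 0) \<and>
     (\<forall>i j. C i j = C j i) \<and>
     (\<forall>i j. i + j > m \<longrightarrow> C i j = 0) \<and>
     (\<forall>i j k. i \<ge> 1 \<and> j \<ge> 1 \<and> k \<ge> 1 \<longrightarrow> C j k * C i (j + k) = C i j * C (i + j) k)}"

text \<open>The basis vector \<open>p\<^sub>i\<close>; the function \<open>x\<close> stands for the sum of all \<open>x i * p\<^sub>i\<close>.\<close>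

definition basis_vec :: "nat \<Rightarrow> nat \<Rightarrow> 'a::field" where
  "basis_vec i = (\<lambda>l. if l = i then 1 else 0)"

definition scale_vec :: "'a::field \<Rightarrow> (nat \<Rightarrow> 'a) \<Rightarrow> (nat \<Rightarrow> 'a)" where
  "scale_vec c x = (\<lambda>l. c * x l)"

text \<open>The linear span of the \<open>p\<^sub>i\<close> with \<open>i \<in> I\<close>, for finite \<open>I\<close>.\<close>

definition coord_space :: "nat set \<Rightarrow> (nat \<Rightarrow> 'a::field) set" where
  "coord_space I = {x. \<forall>i. i \<notin> I \<longrightarrow> x i = 0}"

text \<open>
  Products \<open>p\<^sub>i p\<^sub>j\<close> with \<open>i + j > m\<close> vanish because \<open>C i j = 0\<close> for
  \<open>C \<in> structure_matrices m\<close>.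
\<close>

definition dgca :: "nat \<Rightarrow> (nat \<Rightarrow> nat \<Rightarrow> 'a::field) \<Rightarrow> ('a, nat \<Rightarrow> 'a) graded_algebra" where
  "dgca m C =
     \<lparr> gcarrier = coord_space {1..m},
       gscale = scale_vec,
       gcomp = (\<lambda>d. coord_space ({1..m} \<inter> {d})),
       gmult = (\<lambda>x y. \<Sum>i=1..m. \<Sum>j=1..m. scale_vec (x i * y j * C i j) (basis_vec (i + j))) \<rparr>"

text \<open>The one-dimensional graded vector space spanned by \<open>p\<^sub>n\<close>.\<close>

definition line_space :: "nat \<Rightarrow> ('a::field, nat \<Rightarrow> 'a) graded_space" where
  "line_space n =
     \<lparr> gcarrier = coord_space {n},
       gscale = scale_vec,
       gcomp = (\<lambda>d. coord_space ({n} \<inter> {d})) \<rparr>"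

text \<open>The scalar \<open>\<theta>\<^sub>i\<close> determined by \<open>\<theta>(p\<^sub>i, p\<^bsub>n-i\<^esub>) = \<theta>\<^sub>i p\<^sub>n\<close>, for \<open>i \<in> {1..n-1}\<close>.\<close>

definition cocycle_coeff ::
  "nat \<Rightarrow> ((nat \<Rightarrow> 'a::field) \<Rightarrow> (nat \<Rightarrow> 'a) \<Rightarrow> nat \<Rightarrow> 'a) \<Rightarrow> nat \<Rightarrow> 'a"
where
  "cocycle_coeff n \<theta> i = \<theta> (basis_vec i) (basis_vec (n - i)) n"


section \<open>The graph of a structure matrix\<close>

definition Gr_edges :: "nat \<Rightarrow> (nat \<Rightarrow> nat \<Rightarrow> 'a::field) \<Rightarrow> (nat \<times> nat) set" where
  "Gr_edges n C = {(p, q). p \<in> {1..n-1} \<and> q \<in> {1..n-1} \<and> p \<noteq> q \<and>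
     (p + q = n \<or>
      (\<exists>i j k. i \<ge> 1 \<and> j \<ge> 1 \<and> k \<ge> 1 \<and> i + j + k = n \<and> p = i + j \<and> q = j + k \<and>
         C i j * C j k \<noteq> 0))}"

definition Gr_components :: "nat \<Rightarrow> (nat \<Rightarrow> nat \<Rightarrow> 'a::field) \<Rightarrow> nat set set" where
  "Gr_components n C =
     {1..n-1} // {(p, q). p \<in> {1..n-1} \<and> q \<in> {1..n-1} \<and> (p, q) \<in> (Gr_edges n C)\<^sup>*}"

text \<open>
  The subtraction on \<^typ>\<open>nat\<close> is exact: if \<open>i + j\<close> is a vertex then \<open>i + j < n\<close>.
\<close>

definition contractible_component :: "nat \<Rightarrow> (nat \<Rightarrow> nat \<Rightarrow> 'a::field) \<Rightarrow> nat set \<Rightarrow> bool" where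
  "contractible_component n C K \<longleftrightarrow>
     (\<exists>i j. i \<ge> 1 \<and> j \<ge> 1 \<and> i + j \<in> K \<and> C i j \<noteq> 0 \<and> C j (n - i - j) = 0)"

definition generic_component :: "nat \<Rightarrow> (nat \<Rightarrow> nat \<Rightarrow> 'a::field) \<Rightarrow> nat set \<Rightarrow> bool" where
  "generic_component n C K \<longleftrightarrow> \<not> contractible_component n C K"

definition nonvanishing_component :: "nat \<Rightarrow> (nat \<Rightarrow> nat \<Rightarrow> 'a::field) \<Rightarrow> nat set \<Rightarrow> bool" where
  "nonvanishing_component n C K \<longleftrightarrow>
     generic_component n C K \<and>
     (\<exists>\<theta> \<in> graded_cocycles (dgca (n - 1) C) (line_space n). \<exists>p\<in>K. cocycle_coeff n \<theta> p \<noteq> 0)"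


section \<open>There are no nonzero graded coboundaries\<close>

lemma graded_linear_dgca_line_space_eq_0:
  assumes n: "n \<ge> 1"
    and f: "f \<in> graded_linear_maps (dgca (n - 1) C) (line_space n)"
    and x: "x \<in> coord_space {1..n-1}"
  shows "f x = 0"
proof -
  have add: "f (y + z) = f y + f z"
    if "y \<in> coord_space {1..n-1}" "z \<in> coord_space {1..n-1}" for y z
    using f that by (auto simp: graded_linear_maps_def dgca_def)
  have comp0: "f y = 0" if "d \<in> {1..n-1}" "y \<in> coord_space {d}" for y d
  proof -
    have "y \<in> gcomp (dgca (n - 1) C) d"
      using that by (auto simp: dgca_def coord_space_def)
    then have "f y \<in> coord_space ({n} \<inter> {d})"
      using f by (auto simp: graded_linear_maps_def line_space_def)
    moreover have "{n} \<inter> {d} = {}" using that n by auto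
    ultimately show ?thesis by (auto simp: coord_space_def fun_eq_iff)
  qed
  have zero: "f 0 = 0"
    using add[of 0 0] by (simp add: coord_space_def)
  have "f y = 0" if "m \<le> n - 1" "y \<in> coord_space {1..m}" for m y
    using that
  proof (induction m arbitrary: y)
    case 0
    then have "y = 0" by (auto simp: coord_space_def fun_eq_iff)
    then show ?case using zero by metis
  next
    case (Suc m)
    define u where "u = y(Suc m := 0)"
    define w where "w = (\<lambda>l. if l = Suc m then y l else 0)"
    have y: "y = u + w" by (auto simp: u_def w_def fun_eq_iff)
    have u: "u \<in> coord_space {1..m}"
      using Suc.prems by (auto simp: u_def coord_space_def)
    have w: "w \<in> coord_space {Suc m}" by (auto simp: w_def coord_space_def)
    have "u \<in> coord_space {1..n-1}" "w \<in> coord_space {1..n-1}"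
      using u w Suc.prems(1) by (auto simp: coord_space_def)
    then have "f y = f u + f w" using y add by simp
    moreover have "f u = 0" using Suc.IH Suc.prems(1) u by (simp add: zero_fun_def)
    moreover have "f w = 0" using comp0[OF _ w] Suc.prems(1) by (simp add: zero_fun_def)
    ultimately show ?case by (simp add: zero_fun_def)
  qed
  from this[OF order_refl x] show ?thesis .
qed

lemma gmult_dgca_closed:
  assumes "C \<in> structure_matrices m"
  shows "gmult (dgca m C) x y \<in> coord_space {1..m}"
proof -
  have sum_fun: "(\<Sum>i\<in>I. g i) l = (\<Sum>i\<in>I. g i l)" for g :: "nat \<Rightarrow> nat \<Rightarrow> 'a" and I l
    by (induction I rule: infinite_finite_induct) auto
  show ?thesis
    using assms
    by (auto simp: dgca_def coord_space_def sum_fun scale_vec_def basis_vec_def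
        structure_matrices_def intro!: sum.neutral)
qed

lemma graded_coboundary_dgca_iff:
  assumes "n \<ge> 1" "C \<in> structure_matrices (n - 1)"
  shows "\<theta> \<in> graded_coboundaries (dgca (n - 1) C) (line_space n) \<longleftrightarrow>
    (\<forall>a\<in>gcarrier (dgca (n - 1) C). \<forall>b\<in>gcarrier (dgca (n - 1) C). \<theta> a b = 0)"
proof
  assume "\<theta> \<in> graded_coboundaries (dgca (n - 1) C) (line_space n)"
  then obtain f where f: "f \<in> graded_linear_maps (dgca (n - 1) C) (line_space n)"
    and eq: "\<forall>a\<in>gcarrier (dgca (n - 1) C). \<forall>b\<in>gcarrier (dgca (n - 1) C).
               \<theta> a b = f (gmult (dgca (n - 1) C) a b)"
    by (auto simp: graded_coboundaries_def)
  have "f (gmult (dgca (n - 1) C) a b) = 0" for a b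
    by (rule graded_linear_dgca_line_space_eq_0[OF assms(1) f gmult_dgca_closed[OF assms(2)]])
  with eq show "\<forall>a\<in>gcarrier (dgca (n - 1) C). \<forall>b\<in>gcarrier (dgca (n - 1) C). \<theta> a b = 0"
    by metis
next
  assume *: "\<forall>a\<in>gcarrier (dgca (n - 1) C). \<forall>b\<in>gcarrier (dgca (n - 1) C). \<theta> a b = 0"
  have "(\<lambda>_. 0) \<in> graded_linear_maps (dgca (n - 1) C) (line_space n)"
    by (auto simp: graded_linear_maps_def line_space_def coord_space_def scale_vec_def fun_eq_iff)
  then show "\<theta> \<in> graded_coboundaries (dgca (n - 1) C) (line_space n)"
    using * by (auto simp: graded_coboundaries_def)
qed

end

theory Submission
  imports Defs
begin

text \<open>
  For degree reasons a graded cocycle with values in the line spanned by \<open>p\<^sub>n\<close> is the same thing as its tuple of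
  coefficients \<open>\<theta>\<^sub>i\<close>, subject to linear equations each of which involves at most two of the
  coefficients. The graph records the equations of the form \<open>u * \<theta>\<^sub>p = v * \<theta>\<^sub>q\<close> with
  \<open>u\<close> and \<open>v\<close> both nonzero. An equation with exactly one nonzero factor forces a coefficient to
  vanish, and this is contractibility. This has two consequences.

  Within a connected component every coefficient is a fixed nonzero multiple of any other
  (\<open>connected_coeffs_proportional\<close>). Hence a cocycle is zero either everywhere or nowhere on a
  component, and its restriction to the component is determined up to a scalar.
  Between different components there is no interaction at all: replacing the coefficients outside
  a component by zero yields a cocycle again (\<open>restrict_cocycle_tuple\<close>). The space of cocycles
  is therefore the direct sum of one line for each nonvanishing component.

  A graded isomorphism between extensions scales each of the one-dimensional homogeneous components,
  so it preserves the set of indices where the cocycle is nonzero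
  (\<open>isomorphic_extensions_same_support\<close>). Two nonvanishing components thus give two
  nonisomorphic nontrivial extensions. Conversely, if there is only one nonvanishing component,
  then any two nonzero cocycles are proportional, and rescaling \<open>p\<^sub>n\<close> identifies their extensions
  (\<open>proportional_extensions_isomorphic\<close>). If there is none, there are no nontrivial extensions.
\<close>

section \<open>Graded cocycles as tuples of coefficients\<close>

definition cocycle_tuples :: "nat \<Rightarrow> (nat \<Rightarrow> nat \<Rightarrow> 'a::field) \<Rightarrow> (nat \<Rightarrow> 'a) set" where
  "cocycle_tuples n C = {t.
     (\<forall>p\<in>{1..n-1}. t (n - p) = t p) \<and>
     (\<forall>i j k. i \<ge> 1 \<and> j \<ge> 1 \<and> k \<ge> 1 \<and> i + j + k = n \<longrightarrow>
        t (i + j) * C i j = t (j + k) * C j k)}"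

definition tuple_cocycle ::
  "nat \<Rightarrow> (nat \<Rightarrow> 'a::field) \<Rightarrow> (nat \<Rightarrow> 'a) \<Rightarrow> (nat \<Rightarrow> 'a) \<Rightarrow> nat \<Rightarrow> 'a"
where
  "tuple_cocycle n t a b = scale_vec (\<Sum>i=1..n-1. a i * b (n - i) * t i) (basis_vec n)"

lemma sum_fun_apply: "(\<Sum>i\<in>I. g i) x = (\<Sum>i\<in>I. g i x)"
  for g :: "'i \<Rightarrow> 'x \<Rightarrow> 'b::comm_monoid_add"
  by (induction I rule: infinite_finite_induct) auto

lemma basis_vec_in_coord_space: "i \<in> I \<Longrightarrow> basis_vec i \<in> coord_space I"
  by (auto simp: basis_vec_def coord_space_def)

lemma coord_space_expansion:
  assumes "finite I" "a \<in> coord_space I"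
  shows "a = (\<Sum>i\<in>I. scale_vec (a i) (basis_vec i))"
proof
  fix l
  show "a l = (\<Sum>i\<in>I. scale_vec (a i) (basis_vec i)) l"
    using assms by (auto simp: sum_fun_apply scale_vec_def basis_vec_def coord_space_def
        if_distrib cong: if_cong)
qed

lemma coord_space_singleton_expansion:
  "a \<in> coord_space {i} \<Longrightarrow> a = scale_vec (a i) (basis_vec i)"
  by (auto simp: coord_space_def scale_vec_def basis_vec_def fun_eq_iff)

lemma sum_scale_vec_in_coord_space:
  assumes "\<And>i. i \<in> J \<Longrightarrow> x i \<in> coord_space I"
  shows "(\<Sum>i\<in>J. scale_vec (c i) (x i)) \<in> coord_space I"
  using assms by (auto simp: coord_space_def scale_vec_def sum_fun_apply intro!: sum.neutral)

lemma additive_homogeneous_sum: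
  fixes g :: "(nat \<Rightarrow> 'a::field) \<Rightarrow> nat \<Rightarrow> 'a"
  assumes add: "\<And>x y. x \<in> coord_space I \<Longrightarrow> y \<in> coord_space I \<Longrightarrow> g (x + y) = g x + g y"
    and scale: "\<And>c x. x \<in> coord_space I \<Longrightarrow> g (scale_vec c x) = scale_vec c (g x)"
    and "finite J" "\<And>i. i \<in> J \<Longrightarrow> x i \<in> coord_space I"
  shows "g (\<Sum>i\<in>J. scale_vec (c i) (x i)) = (\<Sum>i\<in>J. scale_vec (c i) (g (x i)))"
  using assms(3,4)
proof (induction J rule: finite_induct)
  case empty
  have "(0 :: nat \<Rightarrow> 'a) \<in> coord_space I" by (simp add: coord_space_def)
  then have "g (0 + 0) = g 0 + g 0" using add by blast
  then have "g 0 = 0" by simp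
  then show ?case unfolding sum.empty .
next
  case (insert j J)
  have x: "scale_vec (c j) (x j) \<in> coord_space I"
    using insert.prems[of j] by (auto simp: coord_space_def scale_vec_def)
  have J: "(\<Sum>i\<in>J. scale_vec (c i) (x i)) \<in> coord_space I"
    using insert.prems by (intro sum_scale_vec_in_coord_space) auto
  show ?case
    unfolding sum.insert[OF insert.hyps] add[OF x J]
    using insert.prems insert.IH scale[of "x j" "c j"] by simp
qed

lemma dgca_simps:
  "gcarrier (dgca m C) = coord_space {1..m}"
  "gscale (dgca m C) = scale_vec"
  "gcomp (dgca m C) d = coord_space ({1..m} \<inter> {d})"
  by (simp_all add: dgca_def)

lemma line_space_simps:
  "gcarrier (line_space n) = coord_space {n}"
  "gscale (line_space n) = scale_vec"
  "gcomp (line_space n) d = coord_space ({n} \<inter> {d})"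
  by (simp_all add: line_space_def)

lemma gmult_dgca_apply:
  "gmult (dgca m C) x y l = (\<Sum>i=1..m. \<Sum>j=1..m. if l = i + j then x i * y j * C i j else 0)"
  by (simp add: dgca_def sum_fun_apply scale_vec_def basis_vec_def if_distrib cong: if_cong)

lemma gmult_dgca_basis:
  assumes "C \<in> structure_matrices m"
  shows "gmult (dgca m C) (basis_vec i) (basis_vec j) = scale_vec (C i j) (basis_vec (i + j))"
proof
  fix l
  have "gmult (dgca m C) (basis_vec i) (basis_vec j) l =
      (\<Sum>i'=1..m. \<Sum>j'=1..m. if i' = i then if j' = j then if l = i + j then C i j else 0 else 0 else 0)"
    unfolding gmult_dgca_apply
    by (intro sum.cong refl) (auto simp: basis_vec_def)
  also have "\<dots> = (\<Sum>i'=1..m. if i' = i then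
      (\<Sum>j'=1..m. if j' = j then if l = i + j then C i j else 0 else 0) else 0)"
    by (intro sum.cong refl) auto
  also have "\<dots> = (if l = i + j then C i j else 0)"
    using assms by (auto simp: structure_matrices_def)
  finally show "gmult (dgca m C) (basis_vec i) (basis_vec j) l =
      scale_vec (C i j) (basis_vec (i + j)) l"
    by (simp add: scale_vec_def basis_vec_def)
qed

lemma graded_cocycleD:
  assumes "\<theta> \<in> graded_cocycles (dgca m C) (line_space n)"
  shows "a \<in> coord_space {1..m} \<Longrightarrow> b \<in> coord_space {1..m} \<Longrightarrow> \<theta> a b \<in> coord_space {n}"
    and "a \<in> coord_space {1..m} \<Longrightarrow> b \<in> coord_space {1..m} \<Longrightarrow> \<theta> a b = \<theta> b a"
    and "a \<in> coord_space {1..m} \<Longrightarrow> a' \<in> coord_space {1..m} \<Longrightarrow> b \<in> coord_space {1..m} \<Longrightarrow>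
      \<theta> (a + a') b = \<theta> a b + \<theta> a' b"
    and "a \<in> coord_space {1..m} \<Longrightarrow> b \<in> coord_space {1..m} \<Longrightarrow> b' \<in> coord_space {1..m} \<Longrightarrow>
      \<theta> a (b + b') = \<theta> a b + \<theta> a b'"
    and "a \<in> coord_space {1..m} \<Longrightarrow> b \<in> coord_space {1..m} \<Longrightarrow>
      \<theta> (scale_vec c a) b = scale_vec c (\<theta> a b)"
    and "a \<in> coord_space {1..m} \<Longrightarrow> b \<in> coord_space {1..m} \<Longrightarrow>
      \<theta> a (scale_vec c b) = scale_vec c (\<theta> a b)"
    and "a \<in> coord_space ({1..m} \<inter> {d}) \<Longrightarrow> b \<in> coord_space ({1..m} \<inter> {e}) \<Longrightarrow>
      \<theta> a b \<in> coord_space ({n} \<inter> {d + e})"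
    and "a \<in> coord_space {1..m} \<Longrightarrow> b \<in> coord_space {1..m} \<Longrightarrow> a'' \<in> coord_space {1..m} \<Longrightarrow>
      \<theta> (gmult (dgca m C) a b) a'' = \<theta> a (gmult (dgca m C) b a'')"
  using assms unfolding graded_cocycles_def
  by (auto simp: dgca_simps line_space_simps)

text \<open>The grading forces a cocycle to pair \<open>p\<^sub>i\<close> with \<open>p\<^bsub>n-i\<^esub>\<close> only.\<close>

lemma graded_cocycle_basis:
  assumes \<theta>: "\<theta> \<in> graded_cocycles (dgca (n - 1) C) (line_space n)"
    and i: "i \<in> {1..n-1}" and j: "j \<in> {1..n-1}"
  shows "\<theta> (basis_vec i) (basis_vec j) =
    (if i + j = n then scale_vec (cocycle_coeff n \<theta> i) (basis_vec n) else 0)"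
proof (cases "i + j = n")
  case True
  then have "j = n - i" by simp
  have "\<theta> (basis_vec i) (basis_vec j) \<in> coord_space {n}"
    using graded_cocycleD(1)[OF \<theta>] basis_vec_in_coord_space[OF i] basis_vec_in_coord_space[OF j]
    by blast
  then show ?thesis
    using coord_space_singleton_expansion \<open>j = n - i\<close> True unfolding cocycle_coeff_def by auto
next
  case False
  have "\<theta> (basis_vec i) (basis_vec j) \<in> coord_space ({n} \<inter> {i + j})"
    by (rule graded_cocycleD(7)[OF \<theta>]) (use i j in \<open>auto intro: basis_vec_in_coord_space\<close>)
  with False show ?thesis by (auto simp: coord_space_def fun_eq_iff)
qed

text \<open>Hence, by bilinearity, a cocycle can be recovered from its coefficients.\<close>

lemma graded_cocycle_eq_tuple_cocycle:
  assumes \<theta>: "\<theta> \<in> graded_cocycles (dgca (n - 1) C) (line_space n)"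
    and a: "a \<in> coord_space {1..n-1}" and b: "b \<in> coord_space {1..n-1}"
  shows "\<theta> a b = tuple_cocycle n (cocycle_coeff n \<theta>) a b"
proof -
  let ?t = "cocycle_coeff n \<theta>"
  have bv: "basis_vec i \<in> coord_space {1..n-1}" if "i \<in> {1..n-1}" for i
    using that by (rule basis_vec_in_coord_space)
  have right: "\<theta> (basis_vec i) b = scale_vec (b (n - i) * ?t i) (basis_vec n)"
    if i: "i \<in> {1..n-1}" for i
  proof -
    have "\<theta> (basis_vec i) b = \<theta> (basis_vec i) (\<Sum>j=1..n-1. scale_vec (b j) (basis_vec j))"
      using coord_space_expansion[OF _ b] by simp
    also have "\<dots> = (\<Sum>j=1..n-1. scale_vec (b j) (\<theta> (basis_vec i) (basis_vec j)))"
    proof (rule additive_homogeneous_sum[where I = "{1..n-1}"])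
      show "\<theta> (basis_vec i) (x + y) = \<theta> (basis_vec i) x + \<theta> (basis_vec i) y"
        if "x \<in> coord_space {1..n-1}" "y \<in> coord_space {1..n-1}" for x y
        using bv[OF i] that by (rule graded_cocycleD(4)[OF \<theta>])
      show "\<theta> (basis_vec i) (scale_vec c x) = scale_vec c (\<theta> (basis_vec i) x)"
        if "x \<in> coord_space {1..n-1}" for c x
        using bv[OF i] that by (rule graded_cocycleD(6)[OF \<theta>])
    qed (use bv in auto)
    also have "\<dots> = (\<Sum>j=1..n-1. if j = n - i then scale_vec (b j * ?t i) (basis_vec n) else 0)"
      using i by (intro sum.cong refl)
        (auto simp: graded_cocycle_basis[OF \<theta> i] scale_vec_def fun_eq_iff)
    also have "\<dots> = scale_vec (b (n - i) * ?t i) (basis_vec n)"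
      using i by (subst sum.delta) auto
    finally show ?thesis .
  qed
  have "\<theta> a b = \<theta> (\<Sum>i=1..n-1. scale_vec (a i) (basis_vec i)) b"
    using coord_space_expansion[OF _ a] by simp
  also have "\<dots> = (\<Sum>i=1..n-1. scale_vec (a i) (\<theta> (basis_vec i) b))"
  proof (rule additive_homogeneous_sum[where I = "{1..n-1}" and g = "\<lambda>x. \<theta> x b"])
    show "\<theta> (x + y) b = \<theta> x b + \<theta> y b"
      if "x \<in> coord_space {1..n-1}" "y \<in> coord_space {1..n-1}" for x y
      using that b by (rule graded_cocycleD(3)[OF \<theta>])
    show "\<theta> (scale_vec c x) b = scale_vec c (\<theta> x b)" if "x \<in> coord_space {1..n-1}" for c x
      using that b by (rule graded_cocycleD(5)[OF \<theta>])
  qed (use bv in auto)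
  also have "\<dots> = (\<Sum>i=1..n-1. scale_vec (a i * b (n - i) * ?t i) (basis_vec n))"
    by (intro sum.cong refl) (simp add: right scale_vec_def mult.assoc)
  also have "\<dots> = tuple_cocycle n ?t a b"
    by (auto simp: tuple_cocycle_def sum_fun_apply scale_vec_def sum_distrib_right)
  finally show ?thesis .
qed

text \<open>
  The two conditions on tuples are symmetry, and associativity on triples of basis vectors of total
  degree \<open>n\<close>.
\<close>

lemma cocycle_coeff_in_cocycle_tuples:
  assumes C: "C \<in> structure_matrices (n - 1)"
    and \<theta>: "\<theta> \<in> graded_cocycles (dgca (n - 1) C) (line_space n)"
  shows "cocycle_coeff n \<theta> \<in> cocycle_tuples n C"
proof -
  let ?t = "cocycle_coeff n \<theta>"
  have bv: "basis_vec i \<in> coord_space {1..n-1}" if "i \<in> {1..n-1}" for i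
    using that by (rule basis_vec_in_coord_space)
  have sym: "?t (n - p) = ?t p" if "p \<in> {1..n-1}" for p
  proof -
    have "n - p \<in> {1..n-1}" "n - (n - p) = p" using that by auto
    then show ?thesis
      using graded_cocycleD(2)[OF \<theta> bv bv, of p "n - p"] that
      unfolding cocycle_coeff_def by simp
  qed
  moreover have "?t (i + j) * C i j = ?t (j + k) * C j k"
    if ijk: "i \<ge> 1" "j \<ge> 1" "k \<ge> 1" "i + j + k = n" for i j k
  proof -
    have I: "i \<in> {1..n-1}" "j \<in> {1..n-1}" "k \<in> {1..n-1}" "i + j \<in> {1..n-1}" "j + k \<in> {1..n-1}"
      using ijk by auto
    have "\<theta> (scale_vec (C i j) (basis_vec (i + j))) (basis_vec k) =
        \<theta> (basis_vec i) (scale_vec (C j k) (basis_vec (j + k)))"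
      using graded_cocycleD(8)[OF \<theta> bv bv bv, of i j k] I unfolding gmult_dgca_basis[OF C] by blast
    then have "scale_vec (C i j) (\<theta> (basis_vec (i + j)) (basis_vec k)) =
        scale_vec (C j k) (\<theta> (basis_vec i) (basis_vec (j + k)))"
      using graded_cocycleD(5,6)[OF \<theta>] bv I by metis
    then have "scale_vec (C i j) (scale_vec (?t (i + j)) (basis_vec n)) n =
        scale_vec (C j k) (scale_vec (?t i) (basis_vec n)) n"
      using graded_cocycle_basis[OF \<theta>] I ijk(4) by (simp add: add.assoc)
    then have "C i j * ?t (i + j) = C j k * ?t i"
      by (simp add: scale_vec_def basis_vec_def)
    moreover have "n - i = j + k" using ijk by simp
    ultimately show ?thesis using sym[OF I(1)] by (simp add: mult.commute)
  qed
  ultimately show ?thesis by (auto simp: cocycle_tuples_def)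
qed

lemma cocycle_coeff_tuple_cocycle:
  assumes "p \<in> {1..n-1}"
  shows "cocycle_coeff n (tuple_cocycle n t) p = t p"
proof -
  have "(\<Sum>i=1..n-1. basis_vec p i * basis_vec (n - p) (n - i) * t i) =
      (\<Sum>i=1..n-1. if i = p then t p else 0)"
    by (intro sum.cong refl) (auto simp: basis_vec_def)
  then show ?thesis
    using assms by (simp add: cocycle_coeff_def tuple_cocycle_def scale_vec_def basis_vec_def)
qed

lemma tuple_cocycle_commute:
  assumes "t \<in> cocycle_tuples n C"
  shows "tuple_cocycle n t a b = tuple_cocycle n t b a"
proof -
  have "(\<Sum>i=1..n-1. a i * b (n - i) * t i) = (\<Sum>i=1..n-1. b i * a (n - i) * t i)"
    by (rule sum.reindex_bij_witness[of _ "\<lambda>i. n - i" "\<lambda>i. n - i"])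
      (use assms in \<open>auto simp: cocycle_tuples_def\<close>)
  then show ?thesis by (simp add: tuple_cocycle_def)
qed

lemma tuple_cocycle_assoc:
  assumes C: "C \<in> structure_matrices (n - 1)" and t: "t \<in> cocycle_tuples n C"
  shows "tuple_cocycle n t (gmult (dgca (n - 1) C) a b) c =
    tuple_cocycle n t a (gmult (dgca (n - 1) C) b c)"
proof -
  let ?m = "n - 1"
  \<comment> \<open>Both sides equal the sum over \<open>i\<close>, \<open>j\<close> of terms in which the third index is
    \<open>n - i - j\<close>; on each side the sum over the degree of the inner product collapses.\<close>
  let ?S = "\<Sum>i=1..?m. \<Sum>j=1..?m.
      if i + j \<le> ?m then a i * b j * c (n - i - j) * (t (i + j) * C i j) else 0"
  have "(\<Sum>l=1..?m. gmult (dgca ?m C) a b l * c (n - l) * t l) =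
      (\<Sum>l=1..?m. \<Sum>i=1..?m. \<Sum>j=1..?m.
         if l = i + j then a i * b j * c (n - i - j) * (t (i + j) * C i j) else 0)"
    unfolding gmult_dgca_apply sum_distrib_right
    by (intro sum.cong refl) auto
  also have "\<dots> = (\<Sum>i=1..?m. \<Sum>l=1..?m. \<Sum>j=1..?m.
         if l = i + j then a i * b j * c (n - i - j) * (t (i + j) * C i j) else 0)"
    by (rule sum.swap)
  also have "\<dots> = (\<Sum>i=1..?m. \<Sum>j=1..?m. \<Sum>l=1..?m.
         if l = i + j then a i * b j * c (n - i - j) * (t (i + j) * C i j) else 0)"
    by (intro sum.cong refl sum.swap)
  also have "\<dots> = ?S"
    by (intro sum.cong refl) auto
  finally have left: "(\<Sum>l=1..?m. gmult (dgca ?m C) a b l * c (n - l) * t l) = ?S" .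

  have "(\<Sum>i=1..?m. a i * gmult (dgca ?m C) b c (n - i) * t i) =
      (\<Sum>i=1..?m. \<Sum>j=1..?m. \<Sum>k=1..?m.
         if n - i = j + k then a i * b j * c k * (t i * C j k) else 0)"
    unfolding gmult_dgca_apply sum_distrib_right sum_distrib_left
    by (intro sum.cong refl) auto
  also have "\<dots> = ?S"
  proof (intro sum.cong refl)
    fix i j assume i: "i \<in> {1..?m}" and j: "j \<in> {1..?m}"
    have "(\<Sum>k=1..?m. if n - i = j + k then a i * b j * c k * (t i * C j k) else 0) =
        (\<Sum>k=1..?m. if k = n - i - j then
           if i + j \<le> ?m then a i * b j * c k * (t i * C j k) else 0 else 0)"
      by (intro sum.cong refl) (use i j in auto)
    also have "\<dots> = (if i + j \<le> ?m then
        a i * b j * c (n - i - j) * (t i * C j (n - i - j)) else 0)"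
      using i j by auto
    also have "\<dots> = (if i + j \<le> ?m then
        a i * b j * c (n - i - j) * (t (i + j) * C i j) else 0)"
    proof (cases "i + j \<le> ?m")
      case True
      then have "i \<ge> 1 \<and> j \<ge> 1 \<and> n - i - j \<ge> 1 \<and> i + j + (n - i - j) = n"
        using i j by auto
      then have "t (i + j) * C i j = t (j + (n - i - j)) * C j (n - i - j)"
        using t unfolding cocycle_tuples_def by blast
      moreover have "j + (n - i - j) = n - i" using True i by auto
      moreover have "t (n - i) = t i" using t i by (auto simp: cocycle_tuples_def)
      ultimately show ?thesis by simp
    qed simp
    finally show "(\<Sum>k=1..?m. if n - i = j + k then a i * b j * c k * (t i * C j k) else 0) = \<dots>" .
  qed
  finally show ?thesis using left by (simp add: tuple_cocycle_def)
qed

lemma tuple_cocycle_in_graded_cocycles: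
  assumes C: "C \<in> structure_matrices (n - 1)" and t: "t \<in> cocycle_tuples n C"
  shows "tuple_cocycle n t \<in> graded_cocycles (dgca (n - 1) C) (line_space n)"
proof -
  have graded: "tuple_cocycle n t a b \<in> coord_space ({n} \<inter> {d + e})"
    if "a \<in> coord_space ({1..n-1} \<inter> {d})" "b \<in> coord_space ({1..n-1} \<inter> {e})" for a b d e
  proof (cases "d + e = n")
    case True
    then show ?thesis
      by (auto simp: tuple_cocycle_def scale_vec_def basis_vec_def coord_space_def)
  next
    case False
    have "a i * b (n - i) * t i = 0" if i: "i \<in> {1..n-1}" for i
    proof (cases "i = d")
      case True
      then have "n - i \<noteq> e" using False i by auto
      then show ?thesis using \<open>b \<in> _\<close> by (auto simp: coord_space_def)
    next
      case False
      then show ?thesis using \<open>a \<in> _\<close> by (auto simp: coord_space_def)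
    qed
    then have "(\<Sum>i=1..n-1. a i * b (n - i) * t i) = 0" by (rule sum.neutral[rule_format])
    then show ?thesis by (simp add: tuple_cocycle_def scale_vec_def coord_space_def)
  qed
  have closed: "tuple_cocycle n t a b \<in> coord_space {n}" for a b
    by (auto simp: tuple_cocycle_def scale_vec_def basis_vec_def coord_space_def)
  have linear:
    "tuple_cocycle n t (a + a') b = tuple_cocycle n t a b + tuple_cocycle n t a' b"
    "tuple_cocycle n t a (b + b') = tuple_cocycle n t a b + tuple_cocycle n t a b'"
    "tuple_cocycle n t (scale_vec c a) b = scale_vec c (tuple_cocycle n t a b)"
    "tuple_cocycle n t a (scale_vec c b) = scale_vec c (tuple_cocycle n t a b)" for a a' b b' c
    by (auto simp: tuple_cocycle_def scale_vec_def fun_eq_iff sum.distrib sum_distrib_left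
        ring_distribs mult_ac)
  show ?thesis
    unfolding graded_cocycles_def dgca_simps line_space_simps mem_Collect_eq
    by (intro conjI ballI allI;
        rule closed linear graded tuple_cocycle_assoc[OF C t] tuple_cocycle_commute[OF t];
        assumption)
qed

text \<open>For degree reasons the only coboundary is zero, and a cocycle is determined by its coefficients.\<close>

lemma noncoboundary_iff_coeff_nonzero:
  assumes "n \<ge> 1" and C: "C \<in> structure_matrices (n - 1)"
    and \<theta>: "\<theta> \<in> graded_cocycles (dgca (n - 1) C) (line_space n)"
  shows "\<theta> \<notin> graded_coboundaries (dgca (n - 1) C) (line_space n) \<longleftrightarrow>
    (\<exists>p\<in>{1..n-1}. cocycle_coeff n \<theta> p \<noteq> 0)"
proof -
  have "(\<forall>a\<in>coord_space {1..n-1}. \<forall>b\<in>coord_space {1..n-1}. \<theta> a b = 0) \<longleftrightarrow>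
      (\<forall>p\<in>{1..n-1}. cocycle_coeff n \<theta> p = 0)"
  proof
    assume 0: "\<forall>a\<in>coord_space {1..n-1}. \<forall>b\<in>coord_space {1..n-1}. \<theta> a b = 0"
    show "\<forall>p\<in>{1..n-1}. cocycle_coeff n \<theta> p = 0"
    proof
      fix p assume "p \<in> {1..n-1}"
      then have "\<theta> (basis_vec p) (basis_vec (n - p)) = 0"
        using 0 by (auto intro!: bspec[OF bspec[OF 0]] basis_vec_in_coord_space)
      then show "cocycle_coeff n \<theta> p = 0" by (simp add: cocycle_coeff_def)
    qed
  next
    assume 0: "\<forall>p\<in>{1..n-1}. cocycle_coeff n \<theta> p = 0"
    show "\<forall>a\<in>coord_space {1..n-1}. \<forall>b\<in>coord_space {1..n-1}. \<theta> a b = 0"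
      using 0 graded_cocycle_eq_tuple_cocycle[OF \<theta>]
      by (auto simp: tuple_cocycle_def scale_vec_def fun_eq_iff)
  qed
  then show ?thesis
    using graded_coboundary_dgca_iff[OF assms(1) C, of \<theta>] unfolding dgca_simps by blast
qed


section \<open>Cocycles along the connected components\<close>

lemma sym_Gr_edges:
  assumes "C \<in> structure_matrices (n - 1)"
  shows "sym (Gr_edges n C)"
proof (rule symI)
  fix p q assume "(p, q) \<in> Gr_edges n C"
  then have *: "p \<in> {1..n-1}" "q \<in> {1..n-1}" "p \<noteq> q"
    and "p + q = n \<or> (\<exists>i j k. i \<ge> 1 \<and> j \<ge> 1 \<and> k \<ge> 1 \<and> i + j + k = n \<and> p = i + j \<and> q = j + k \<and>
         C i j * C j k \<noteq> 0)"
    by (auto simp: Gr_edges_def)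
  from this(4) have "q + p = n \<or>
      (\<exists>i j k. i \<ge> 1 \<and> j \<ge> 1 \<and> k \<ge> 1 \<and> i + j + k = n \<and> q = i + j \<and> p = j + k \<and>
         C i j * C j k \<noteq> 0)"
  proof (elim disjE exE)
    fix i j k
    assume ijk: "i \<ge> 1 \<and> j \<ge> 1 \<and> k \<ge> 1 \<and> i + j + k = n \<and> p = i + j \<and> q = j + k \<and>
         C i j * C j k \<noteq> 0"
    moreover have "C i j = C j i" "C j k = C k j"
      using assms by (simp_all add: structure_matrices_def)
    ultimately have "k \<ge> 1 \<and> j \<ge> 1 \<and> i \<ge> 1 \<and> k + j + i = n \<and> q = k + j \<and> p = j + i \<and>
         C k j * C j i \<noteq> 0"
      by (auto simp: mult.commute)
    then show ?thesis by blast
  qed auto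
  with * show "(q, p) \<in> Gr_edges n C" unfolding Gr_edges_def by auto
qed

lemma equiv_Gr_connected:
  assumes "C \<in> structure_matrices (n - 1)"
  shows "equiv {1..n-1} {(p, q). p \<in> {1..n-1} \<and> q \<in> {1..n-1} \<and> (p, q) \<in> (Gr_edges n C)\<^sup>*}"
proof (rule equivI)
  show "sym {(p, q). p \<in> {1..n-1} \<and> q \<in> {1..n-1} \<and> (p, q) \<in> (Gr_edges n C)\<^sup>*}"
    using sym_rtrancl[OF sym_Gr_edges[OF assms]] by (auto simp: sym_def)
qed (auto simp: refl_on_def trans_def)

lemma Gr_componentD:
  assumes C: "C \<in> structure_matrices (n - 1)" and K: "K \<in> Gr_components n C"
  shows "K \<subseteq> {1..n-1}"
    and "p \<in> K \<Longrightarrow> q \<in> K \<Longrightarrow> (p, q) \<in> (Gr_edges n C)\<^sup>*"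
    and "(p, q) \<in> Gr_edges n C \<Longrightarrow> p \<in> K \<longleftrightarrow> q \<in> K"
    and "K' \<in> Gr_components n C \<Longrightarrow> p \<in> K \<Longrightarrow> p \<in> K' \<Longrightarrow> K = K'"
proof -
  let ?R = "{(p, q). p \<in> {1..n-1} \<and> q \<in> {1..n-1} \<and> (p, q) \<in> (Gr_edges n C)\<^sup>*}"
  note E = equiv_Gr_connected[OF C]
  have K': "K \<in> {1..n-1} // ?R" using K by (simp add: Gr_components_def)
  show sub: "K \<subseteq> {1..n-1}" using K' E by (rule in_quotient_imp_subset[rotated])
  show "p \<in> K \<Longrightarrow> q \<in> K \<Longrightarrow> (p, q) \<in> (Gr_edges n C)\<^sup>*"
    using quotient_eq_iff[OF E K' K', of p q] by auto
  have closed: "q \<in> K" if "(p, q) \<in> Gr_edges n C" "p \<in> K" for p q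
  proof (rule in_quotient_imp_closed[OF E K' that(2)])
    show "(p, q) \<in> ?R" using that by (auto simp: Gr_edges_def)
  qed
  show "(p, q) \<in> Gr_edges n C \<Longrightarrow> p \<in> K \<longleftrightarrow> q \<in> K"
    using closed symD[OF sym_Gr_edges[OF C]] by blast
  show "K' \<in> Gr_components n C \<Longrightarrow> p \<in> K \<Longrightarrow> p \<in> K' \<Longrightarrow> K = K'"
    using quotient_disj[OF E K'] unfolding Gr_components_def by blast
qed

lemma vertex_in_Gr_component:
  assumes "p \<in> {1..n-1}"
  obtains K where "K \<in> Gr_components n C" "p \<in> K"
proof
  let ?R = "{(p, q). p \<in> {1..n-1} \<and> q \<in> {1..n-1} \<and> (p, q) \<in> (Gr_edges n C)\<^sup>*}"
  show "?R `` {p} \<in> Gr_components n C"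
    unfolding Gr_components_def using assms by (rule quotientI)
  show "p \<in> ?R `` {p}" using assms by auto
qed

text \<open>
  The ratio depends on the path only, not on the cocycle; this uniformity makes the restrictions of
  all cocycles to a component proportional to each other.
\<close>

lemma connected_coeffs_proportional:
  assumes "(p, q) \<in> (Gr_edges n C)\<^sup>*"
  shows "\<exists>r. r \<noteq> 0 \<and> (\<forall>t \<in> cocycle_tuples n C. t q = r * t p)"
  using assms
proof (induction rule: rtrancl_induct)
  case base
  show ?case by (rule exI[of _ 1]) auto
next
  case (step q s)
  then obtain r where r: "r \<noteq> 0" "\<And>t. t \<in> cocycle_tuples n C \<Longrightarrow> t q = r * t p" by blast
  have "\<exists>u. u \<noteq> 0 \<and> (\<forall>t \<in> cocycle_tuples n C. t s = u * t q)"
  proof (cases "q + s = n")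
    case True
    have "q \<in> {1..n-1}" "s = n - q" using step.hyps(2) True by (auto simp: Gr_edges_def)
    then show ?thesis by (intro exI[of _ 1]) (auto simp: cocycle_tuples_def)
  next
    case False
    then obtain i j k where ijk: "i \<ge> 1 \<and> j \<ge> 1 \<and> k \<ge> 1 \<and> i + j + k = n"
      and qs: "q = i + j" "s = j + k" and ne: "C i j \<noteq> 0" "C j k \<noteq> 0"
      using step.hyps(2) by (auto simp: Gr_edges_def)
    have "t s = C i j / C j k * t q" if "t \<in> cocycle_tuples n C" for t
    proof -
      have "t q * C i j = t s * C j k" using that ijk qs unfolding cocycle_tuples_def by blast
      then show ?thesis using ne by (simp add: field_simps)
    qed
    then show ?thesis using ne by (intro exI[of _ "C i j / C j k"]) auto
  qed
  then obtain u where "u \<noteq> 0" "\<And>t. t \<in> cocycle_tuples n C \<Longrightarrow> t s = u * t q" by blast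
  with r show ?case by (intro exI[of _ "u * r"]) (simp add: mult.assoc)
qed

lemma coeff_nonzero_on_component:
  assumes C: "C \<in> structure_matrices (n - 1)" and K: "K \<in> Gr_components n C"
    and t: "t \<in> cocycle_tuples n C" and "p \<in> K" "q \<in> K" "t p \<noteq> 0"
  shows "t q \<noteq> 0"
  using connected_coeffs_proportional[OF Gr_componentD(2)[OF C K \<open>p \<in> K\<close> \<open>q \<in> K\<close>]] t \<open>t p \<noteq> 0\<close>
  by auto

text \<open>
  An equation linking two different components has a zero factor, since otherwise it would be an
  edge; such an equation says of each side separately that it vanishes.
\<close>

lemma restrict_cocycle_tuple:
  assumes C: "C \<in> structure_matrices (n - 1)" and K: "K \<in> Gr_components n C"
    and t: "t \<in> cocycle_tuples n C"
  shows "(\<lambda>p. if p \<in> K then t p else 0) \<in> cocycle_tuples n C"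
proof -
  have "n - p \<in> K \<longleftrightarrow> p \<in> K" if p: "p \<in> {1..n-1}" for p
  proof (cases "n - p = p")
    case False
    then have "(n - p, p) \<in> Gr_edges n C" using p by (auto simp: Gr_edges_def)
    then show ?thesis by (rule Gr_componentD(3)[OF C K])
  qed simp
  moreover have "(if i + j \<in> K then t (i + j) else 0) * C i j =
      (if j + k \<in> K then t (j + k) else 0) * C j k"
    if ijk: "i \<ge> 1 \<and> j \<ge> 1 \<and> k \<ge> 1 \<and> i + j + k = n" for i j k
  proof -
    have eq: "t (i + j) * C i j = t (j + k) * C j k"
      using t ijk unfolding cocycle_tuples_def by blast
    show ?thesis
    proof (cases "i + j \<in> K \<longleftrightarrow> j + k \<in> K")
      case True
      then show ?thesis using eq by auto
    next
      case False
      have "C i j * C j k = 0"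
      proof (rule ccontr)
        assume ne: "C i j * C j k \<noteq> 0"
        have "(i + j, j + k) \<in> Gr_edges n C"
          using ijk ne False unfolding Gr_edges_def by (auto simp: add.commute)
        with False show False using Gr_componentD(3)[OF C K] by blast
      qed
      then show ?thesis using eq by auto
    qed
  qed
  ultimately show ?thesis
    using t by (auto simp: cocycle_tuples_def)
qed

text \<open>
  Genericity is implied by a nonzero value: a contractible component contains a vertex whose
  coefficient, multiplied by a nonzero constant, is zero.
\<close>

lemma nonvanishing_component_iff:
  assumes C: "C \<in> structure_matrices (n - 1)" and K: "K \<in> Gr_components n C"
  shows "nonvanishing_component n C K \<longleftrightarrow> (\<exists>t \<in> cocycle_tuples n C. \<exists>p\<in>K. t p \<noteq> 0)"
proof
  assume "nonvanishing_component n C K"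
  then show "\<exists>t \<in> cocycle_tuples n C. \<exists>p\<in>K. t p \<noteq> 0"
    using cocycle_coeff_in_cocycle_tuples[OF C] unfolding nonvanishing_component_def by blast
next
  assume "\<exists>t \<in> cocycle_tuples n C. \<exists>p\<in>K. t p \<noteq> 0"
  then obtain t p where t: "t \<in> cocycle_tuples n C" and p: "p \<in> K" "t p \<noteq> 0" by blast
  have "generic_component n C K"
    unfolding generic_component_def
  proof
    assume "contractible_component n C K"
    then obtain i j where ij: "i \<ge> 1" "j \<ge> 1" "i + j \<in> K" "C i j \<noteq> 0" "C j (n - i - j) = 0"
      unfolding contractible_component_def by blast
    have "n - i - j \<ge> 1 \<and> i + j + (n - i - j) = n"
      using ij(3) Gr_componentD(1)[OF C K] by force
    then have "t (i + j) * C i j = t (j + (n - i - j)) * C j (n - i - j)"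
      using t ij(1,2) unfolding cocycle_tuples_def by blast
    then have "t (i + j) = 0" using ij by simp
    moreover have "t (i + j) \<noteq> 0" by (rule coeff_nonzero_on_component[OF C K t p(1) ij(3) p(2)])
    ultimately show False by simp
  qed
  moreover have "cocycle_coeff n (tuple_cocycle n t) p \<noteq> 0"
    using p Gr_componentD(1)[OF C K] cocycle_coeff_tuple_cocycle[of p n t] by auto
  ultimately show "nonvanishing_component n C K"
    using tuple_cocycle_in_graded_cocycles[OF C t] p(1) unfolding nonvanishing_component_def by blast
qed

section \<open>Isomorphisms of central extensions\<close>

text \<open>
  The product of \<open>p\<^sub>i\<close> and \<open>p\<^bsub>n-i\<^esub>\<close> is \<open>\<theta>\<^sub>i p\<^sub>n\<close>. An isomorphism sends both factors to scalar
  multiples of themselves, whose product is a multiple of \<open>\<theta>'\<^sub>i p\<^sub>n\<close>; by injectivity this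
  cannot be zero when \<open>\<theta>\<^sub>i\<close> is nonzero.
\<close>

lemma isomorphic_extensions_same_support:
  assumes C: "C \<in> structure_matrices (n - 1)"
    and \<theta>: "\<theta> \<in> graded_cocycles (dgca (n - 1) C) (line_space n)"
    and \<theta>': "\<theta>' \<in> graded_cocycles (dgca (n - 1) C) (line_space n)"
    and iso: "isomorphic_graded_algebras (central_extension (dgca (n - 1) C) (line_space n) \<theta>)
      (central_extension (dgca (n - 1) C) (line_space n) \<theta>')"
    and p: "p \<in> {1..n-1}" and nz: "cocycle_coeff n \<theta> p \<noteq> 0"
  shows "cocycle_coeff n \<theta>' p \<noteq> 0"
proof
  assume 0: "cocycle_coeff n \<theta>' p = 0"
  let ?E = "central_extension (dgca (n - 1) C) (line_space n)"
  define X where "X = (coord_space {1..n-1} :: (nat \<Rightarrow> 'a) set) \<times> (coord_space {n} :: (nat \<Rightarrow> 'a) set)"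
  have E: "gcarrier (?E \<phi>) = X"
    "gmult (?E \<phi>) (a, v) (b, w) = (gmult (dgca (n - 1) C) a b, \<phi> a b)"
    "gcomp (?E \<phi>) d = coord_space ({1..n-1} \<inter> {d}) \<times> coord_space ({n} \<inter> {d})" for \<phi> a b v w d
    by (simp_all add: central_extension_def dgca_def line_space_def X_def)
  obtain f where f: "f \<in> graded_linear_maps (?E \<theta>) (?E \<theta>')" and bij: "bij_betw f X X"
    and mult: "\<And>x y. x \<in> X \<Longrightarrow> y \<in> X \<Longrightarrow> f (gmult (?E \<theta>) x y) = gmult (?E \<theta>') (f x) (f y)"
    using iso unfolding isomorphic_graded_algebras_def E(1) by blast
  have add: "f (x + y) = f x + f y" if "x \<in> X" "y \<in> X" for x y
    using f that unfolding graded_linear_maps_def E(1) by blast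
  have zero: "(0 :: (nat \<Rightarrow> 'a) \<times> (nat \<Rightarrow> 'a)) \<in> X" by (simp add: X_def coord_space_def zero_prod_def)
  have f0: "f 0 = 0" using add[OF zero zero] by simp
  have bv: "basis_vec i \<in> coord_space {1..n-1}" if "i \<in> {1..n-1}" for i
    using that by (rule basis_vec_in_coord_space)
  have image: "\<exists>c v. f (basis_vec i, 0) = (scale_vec c (basis_vec i), v)" if i: "i \<in> {1..n-1}" for i
  proof -
    have "(basis_vec i, 0) \<in> gcomp (?E \<theta>) i"
      using i unfolding E(3) by (auto simp: coord_space_def basis_vec_def)
    then have "f (basis_vec i, 0) \<in> gcomp (?E \<theta>') i"
      using f unfolding graded_linear_maps_def by blast
    then have "fst (f (basis_vec i, 0)) \<in> coord_space {i}"
      using i unfolding E(3) by (auto simp: coord_space_def)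
    from coord_space_singleton_expansion[OF this] show ?thesis by (metis prod.collapse)
  qed
  have q: "n - p \<in> {1..n-1}" "p + (n - p) = n" using p by auto
  obtain c v d w where cd: "f (basis_vec p, 0) = (scale_vec c (basis_vec p), v)"
    "f (basis_vec (n - p), 0) = (scale_vec d (basis_vec (n - p)), w)"
    using image[OF p] image[OF q(1)] by blast
  have in_X: "(basis_vec p, 0) \<in> X" "(basis_vec (n - p), 0) \<in> X"
    using bv[OF p] bv[OF q(1)] by (auto simp: X_def coord_space_def)
  have sv: "scale_vec c (basis_vec i) \<in> coord_space {1..n-1}" if "i \<in> {1..n-1}" for c i
    using bv[OF that] by (auto simp: coord_space_def scale_vec_def)
  have "\<theta>' (scale_vec c (basis_vec p)) (scale_vec d (basis_vec (n - p))) =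
      scale_vec c (scale_vec d (\<theta>' (basis_vec p) (basis_vec (n - p))))"
    using graded_cocycleD(5,6)[OF \<theta>'] bv sv p q(1) by metis
  then have \<theta>'0: "\<theta>' (scale_vec c (basis_vec p)) (scale_vec d (basis_vec (n - p))) = 0"
    using graded_cocycle_basis[OF \<theta>' p q(1)] 0 q(2)
    by (auto simp: scale_vec_def fun_eq_iff)
  \<comment> \<open>In the algebra itself there is no room for a product of degree \<open>n\<close>.\<close>
  have prod0: "gmult (dgca (n - 1) C) (scale_vec c (basis_vec p)) (scale_vec d (basis_vec (n - p))) = 0"
    for c d
  proof
    fix l
    have "(if l = i + j then scale_vec c (basis_vec p) i * scale_vec d (basis_vec (n - p)) j * C i j
        else 0) = 0" for i j
      using C p by (auto simp: structure_matrices_def scale_vec_def basis_vec_def)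
    then show "gmult (dgca (n - 1) C) (scale_vec c (basis_vec p)) (scale_vec d (basis_vec (n - p))) l
        = 0 l"
      unfolding gmult_dgca_apply by simp
  qed
  have one: "scale_vec 1 x = x" for x :: "nat \<Rightarrow> 'a" by (simp add: scale_vec_def)
  have "f (0 :: nat \<Rightarrow> 'a, \<theta> (basis_vec p) (basis_vec (n - p))) = f 0"
    unfolding f0 using mult[OF in_X, unfolded cd E(2) \<theta>'0 prod0 prod0[of 1 1, unfolded one]]
    by (simp add: zero_prod_def)
  moreover have "(0 :: nat \<Rightarrow> 'a, \<theta> (basis_vec p) (basis_vec (n - p))) \<in> X"
    using graded_cocycleD(1)[OF \<theta> bv[OF p] bv[OF q(1)]] by (simp add: X_def coord_space_def)
  ultimately have "(0 :: nat \<Rightarrow> 'a, \<theta> (basis_vec p) (basis_vec (n - p))) = 0"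
    using zero by (rule inj_onD[OF bij_betw_imp_inj_on[OF bij]])
  then have "cocycle_coeff n \<theta> p = 0" by (simp add: cocycle_coeff_def zero_prod_def)
  with nz show False ..
qed

text \<open>The isomorphism is the identity on the algebra and multiplication by \<open>c\<close> on the line.\<close>

lemma proportional_extensions_isomorphic:
  assumes c: "c \<noteq> 0"
    and proportional: "\<And>a b. a \<in> coord_space {1..n-1} \<Longrightarrow> b \<in> coord_space {1..n-1} \<Longrightarrow>
      \<theta>' a b = scale_vec c (\<theta> a b)"
  shows "isomorphic_graded_algebras (central_extension (dgca (n - 1) C) (line_space n) \<theta>)
    (central_extension (dgca (n - 1) C) (line_space n) \<theta>')"
proof -
  let ?E = "central_extension (dgca (n - 1) C) (line_space n)"
  define f where "f = (\<lambda>(a :: nat \<Rightarrow> 'a, v). (a, scale_vec c v))"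
  define g where "g = (\<lambda>(a :: nat \<Rightarrow> 'a, v). (a, scale_vec (inverse c) v))"
  have "f \<in> graded_linear_maps (?E \<theta>) (?E \<theta>')"
    by (auto simp: graded_linear_maps_def central_extension_def dgca_def line_space_def f_def
        coord_space_def scale_vec_def fun_eq_iff algebra_simps)
  moreover have "bij_betw f (gcarrier (?E \<theta>)) (gcarrier (?E \<theta>'))"
    by (rule bij_betw_byWitness[where f' = g])
      (use c in \<open>auto simp: central_extension_def dgca_def line_space_def f_def g_def
        coord_space_def scale_vec_def fun_eq_iff\<close>)
  moreover have "f (gmult (?E \<theta>) x y) = gmult (?E \<theta>') (f x) (f y)"
    if "x \<in> gcarrier (?E \<theta>)" "y \<in> gcarrier (?E \<theta>)" for x y
    using that proportional by (auto simp: central_extension_def dgca_def line_space_def f_def)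
  ultimately show ?thesis unfolding isomorphic_graded_algebras_def by blast
qed

lemma isomorphic_graded_algebras_refl: "isomorphic_graded_algebras A A"
  unfolding isomorphic_graded_algebras_def graded_linear_maps_def
  by (rule bexI[of _ "\<lambda>x. x"]) (auto simp: bij_betw_def)

lemma unique_isomorphism_class_iff:
  "(\<exists>!K. K \<in> isomorphism_classes X) \<longleftrightarrow>
    X \<noteq> {} \<and> (\<forall>A\<in>X. \<forall>B\<in>X. isomorphic_graded_algebras A B)"
proof -
  define R where "R = {(A, B). A \<in> X \<and> B \<in> X \<and> isomorphic_graded_algebras A B}"
  have R: "isomorphism_classes X = X // R" by (simp add: isomorphism_classes_def R_def)
  show ?thesis
  proof
    assume unique: "\<exists>!K. K \<in> isomorphism_classes X"
    have "isomorphic_graded_algebras A B" if "A \<in> X" "B \<in> X" for A B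
    proof -
      have "R `` {A} = R `` {B}"
        using unique quotientI[OF that(1)] quotientI[OF that(2)] unfolding R by blast
      moreover have "B \<in> R `` {B}"
        using that isomorphic_graded_algebras_refl[of B] by (auto simp: R_def)
      ultimately show ?thesis by (auto simp: R_def)
    qed
    moreover have "X \<noteq> {}" using unique unfolding R by auto
    ultimately show "X \<noteq> {} \<and> (\<forall>A\<in>X. \<forall>B\<in>X. isomorphic_graded_algebras A B)" by blast
  next
    assume *: "X \<noteq> {} \<and> (\<forall>A\<in>X. \<forall>B\<in>X. isomorphic_graded_algebras A B)"
    then have "R `` {A} = X" if "A \<in> X" for A using that by (auto simp: R_def)
    then have "isomorphism_classes X = {X}"
      using * unfolding R quotient_def by auto
    then show "\<exists>!K. K \<in> isomorphism_classes X" by simp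
  qed
qed


section \<open>The criterion\<close>

theorem theorem3p20:
  fixes n :: nat
    and C :: "nat \<Rightarrow> nat \<Rightarrow> 'a::alg_closed_field"
  assumes "n \<ge> 2"
    and "C \<in> structure_matrices (n - 1)"
  shows "(\<exists>!K. K \<in> isomorphism_classes
              (nontrivial_central_extensions (dgca (n - 1) C) (line_space n)))
     \<longleftrightarrow> (\<exists>!K. K \<in> Gr_components n C \<and> nonvanishing_component n C K)"
proof -
  note C = assms(2)
  have n1: "n \<ge> 1" using assms(1) by simp
  let ?E = "central_extension (dgca (n - 1) C) (line_space n)"
  let ?Z = "graded_cocycles (dgca (n - 1) C) (line_space n)"
  let ?NZ = "{\<theta> \<in> ?Z. \<exists>p\<in>{1..n-1}. cocycle_coeff n \<theta> p \<noteq> 0}"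
  let ?NV = "{K \<in> Gr_components n C. nonvanishing_component n C K}"
  have "?Z - graded_coboundaries (dgca (n - 1) C) (line_space n) = ?NZ"
    using noncoboundary_iff_coeff_nonzero[OF n1 C] by blast
  then have extensions: "nontrivial_central_extensions (dgca (n - 1) C) (line_space n) = ?E ` ?NZ"
    by (simp add: nontrivial_central_extensions_def)
  have coeff: "cocycle_coeff n \<theta> \<in> cocycle_tuples n C" if "\<theta> \<in> ?Z" for \<theta>
    using cocycle_coeff_in_cocycle_tuples[OF C that] .
  have supported: "\<exists>K\<in>?NV. p \<in> K" if \<theta>: "\<theta> \<in> ?Z" and p: "p \<in> {1..n-1}" "cocycle_coeff n \<theta> p \<noteq> 0" for \<theta> p
  proof -
    obtain K where K: "K \<in> Gr_components n C" "p \<in> K"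
      using vertex_in_Gr_component[OF p(1)] .
    then show ?thesis using nonvanishing_component_iff[OF C K(1)] coeff[OF \<theta>] p(2) by blast
  qed
  have witness: "\<exists>\<theta>\<in>?NZ. \<forall>p\<in>{1..n-1}. cocycle_coeff n \<theta> p \<noteq> 0 \<longleftrightarrow> p \<in> K"
    if KV: "K \<in> ?NV" for K
  proof -
    have K: "K \<in> Gr_components n C" using KV by simp
    obtain t p where t: "t \<in> cocycle_tuples n C" and p: "p \<in> K" "t p \<noteq> 0"
      using nonvanishing_component_iff[OF C K] KV by blast
    define s where "s = (\<lambda>q. if q \<in> K then t q else 0)"
    have s: "s \<in> cocycle_tuples n C" unfolding s_def by (rule restrict_cocycle_tuple[OF C K t])
    have iff: "\<forall>q\<in>{1..n-1}. cocycle_coeff n (tuple_cocycle n s) q \<noteq> 0 \<longleftrightarrow> q \<in> K"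
      using coeff_nonzero_on_component[OF C K t p(1) _ p(2)]
      by (auto simp: cocycle_coeff_tuple_cocycle s_def)
    have "tuple_cocycle n s \<in> ?NZ"
      using iff p(1) Gr_componentD(1)[OF C K] tuple_cocycle_in_graded_cocycles[OF C s] by blast
    with iff show ?thesis by blast
  qed
  have "(?NZ \<noteq> {} \<and> (\<forall>\<theta>\<in>?NZ. \<forall>\<theta>'\<in>?NZ. isomorphic_graded_algebras (?E \<theta>) (?E \<theta>')))
      \<longleftrightarrow> (\<exists>!K. K \<in> ?NV)"
  proof
    assume *: "?NZ \<noteq> {} \<and> (\<forall>\<theta>\<in>?NZ. \<forall>\<theta>'\<in>?NZ. isomorphic_graded_algebras (?E \<theta>) (?E \<theta>'))"
    then have "?NV \<noteq> {}" using supported by blast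
    moreover have "K = K'" if K: "K \<in> ?NV" and K': "K' \<in> ?NV" for K K'
    proof -
      obtain \<theta> where \<theta>: "\<theta> \<in> ?NZ" "\<forall>p\<in>{1..n-1}. cocycle_coeff n \<theta> p \<noteq> 0 \<longleftrightarrow> p \<in> K"
        using witness[OF K] by blast
      obtain \<theta>' where \<theta>': "\<theta>' \<in> ?NZ" "\<forall>p\<in>{1..n-1}. cocycle_coeff n \<theta>' p \<noteq> 0 \<longleftrightarrow> p \<in> K'"
        using witness[OF K'] by blast
      obtain p where p: "p \<in> {1..n-1}" "cocycle_coeff n \<theta> p \<noteq> 0" using \<theta>(1) by blast
      have "isomorphic_graded_algebras (?E \<theta>) (?E \<theta>')" using * \<theta>(1) \<theta>'(1) by blast
      then have "cocycle_coeff n \<theta>' p \<noteq> 0"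
        using isomorphic_extensions_same_support[OF C _ _ _ p] \<theta>(1) \<theta>'(1) by blast
      then have "p \<in> K" "p \<in> K'" using \<theta>(2) \<theta>'(2) p by blast+
      then show ?thesis using Gr_componentD(4)[OF C] K K' by blast
    qed
    ultimately show "\<exists>!K. K \<in> ?NV" by blast
  next
    assume "\<exists>!K. K \<in> ?NV"
    then obtain K where K: "K \<in> ?NV" and unique: "\<And>K'. K' \<in> ?NV \<Longrightarrow> K' = K" by blast
    have "?NZ \<noteq> {}" using witness[OF K] by blast
    moreover have "isomorphic_graded_algebras (?E \<theta>) (?E \<theta>')"
      if \<theta>: "\<theta> \<in> ?NZ" and \<theta>': "\<theta>' \<in> ?NZ" for \<theta> \<theta>'
    proof -
      let ?t = "cocycle_coeff n \<theta>" and ?t' = "cocycle_coeff n \<theta>'"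
      have KC: "K \<in> Gr_components n C" using K by simp
      have t: "?t \<in> cocycle_tuples n C" "?t' \<in> cocycle_tuples n C"
        using coeff \<theta> \<theta>' by blast+
      have outside: "?t q = 0 \<and> ?t' q = 0" if "q \<in> {1..n-1}" "q \<notin> K" for q
        using supported unique \<theta> \<theta>' that by blast
      obtain p where p: "p \<in> {1..n-1}" "p \<in> K" "?t p \<noteq> 0" using \<theta> outside by blast
      obtain p' where p': "p' \<in> K" "?t' p' \<noteq> 0" using \<theta>' outside by blast
      have t'p: "?t' p \<noteq> 0" by (rule coeff_nonzero_on_component[OF C KC t(2) p'(1) p(2) p'(2)])
      define c where "c = ?t' p / ?t p"
      have proportional: "?t' q = c * ?t q" if q: "q \<in> {1..n-1}" for q
      proof (cases "q \<in> K")
        case True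
        obtain r where "\<And>s. s \<in> cocycle_tuples n C \<Longrightarrow> s q = r * s p"
          using connected_coeffs_proportional[OF Gr_componentD(2)[OF C KC p(2) True]] by blast
        from this[OF t(1)] this[OF t(2)] show ?thesis using p(3) by (simp add: c_def)
      next
        case False
        then show ?thesis using outside[OF q] by simp
      qed
      show ?thesis
      proof (rule proportional_extensions_isomorphic)
        show "c \<noteq> 0" using t'p p(3) by (simp add: c_def)
        fix a b :: "nat \<Rightarrow> 'a"
        assume ab: "a \<in> coord_space {1..n-1}" "b \<in> coord_space {1..n-1}"
        have sums: "(\<Sum>i=1..n-1. a i * b (n - i) * ?t' i) = c * (\<Sum>i=1..n-1. a i * b (n - i) * ?t i)"
          unfolding sum_distrib_left by (intro sum.cong refl) (simp add: proportional)
        have "\<theta> a b = tuple_cocycle n ?t a b" "\<theta>' a b = tuple_cocycle n ?t' a b"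
          using graded_cocycle_eq_tuple_cocycle ab \<theta> \<theta>' by blast+
        then show "\<theta>' a b = scale_vec c (\<theta> a b)"
          using sums by (simp add: tuple_cocycle_def scale_vec_def mult.assoc)
      qed
    qed
    ultimately show "?NZ \<noteq> {} \<and>
        (\<forall>\<theta>\<in>?NZ. \<forall>\<theta>'\<in>?NZ. isomorphic_graded_algebras (?E \<theta>) (?E \<theta>'))"
      by blast
  qed
  then show ?thesis unfolding unique_isomorphism_class_iff extensions by simp
qed

end
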